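(* Let $n\ge 1$ be an integer. If $n$ is even, then both $\Gamma_n$ and $\Delta_{n+1}$ have content $1$. If $n$ is odd, then both $\Gamma_n$ and $\Delta_{n+1}$ have content $2$.
   Context: For an integer $m\ge 1$ let $\{d_{ij} : 0\le i<j\le m\}$ be a set of $m(m+1)/2$ independent variables, and put $d_{ji}:=d_{ij}$. Let $D_m$ be the symmetric $(m+1)\times(m+1)$ matrix with rows and columns indexed by $0,\dots,m$, with zero diagonal and $(i,j)$ entry $d_{ij}^2$ for $i\neq j$. Define $\Delta_m:=\det(D_m)\in\mathbb{Z}[d_{ij}: 0\le i<j\le m]$. Let $\mathrm{CM}_m$ be the symmetric $(m+2)\times(m+2)$ matrix obtained from $D_m$ by adding a new first row and a new first column, both equal to $(0,1,1,\dots,1)$: $$\mathrm{CM}_m = \begin{bmatrix} 0 & 1 & \cdots & 1\\ 1 & & & \\ \vdots & & D_m & \\ 1 & & & \end{bmatrix}.$$ Define $\Gamma_m:=\det(\mathrm{CM}_m)\in\mathbb{Z}[d_{ij}: 0\le i<j\le m]$ (the Cayley-Menger determinant). The content of a polynomial with integer coefficients is the (nonnegative) gcd of its coefficients. *)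

theory Defs
  imports "HOL-Library.Poly_Mapping" "Jordan_Normal_Form.Determinant"
begin

text \<open>
  Integer polynomials in variables indexed by \<open>nat \<times> nat\<close>: a monomial is a finitely supported
  exponent vector, a polynomial a finitely supported map from monomials to coefficients.
  All the rings \<open>\<int>[d\<^sub>i\<^sub>j : 0 \<le> i < j \<le> m]\<close> are embedded in this one ring;
  enlarging the set of variables does not change the coefficients of a polynomial.
\<close>
type_synonym dist_poly = "((nat \<times> nat) \<Rightarrow>\<^sub>0 nat) \<Rightarrow>\<^sub>0 int"

text \<open>The index is the pair sorted increasingly, so that \<open>d\<^sub>i\<^sub>j = d\<^sub>j\<^sub>i\<close>.\<close>
definition dvar :: "nat \<Rightarrow> nat \<Rightarrow> dist_poly" where
  "dvar i j = Poly_Mapping.single (Poly_Mapping.single (min i j, max i j) 1) 1"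

definition D_mat :: "nat \<Rightarrow> dist_poly mat" where
  "D_mat m = mat (m + 1) (m + 1) (\<lambda>(i, j). if i = j then 0 else (dvar i j)\<^sup>2)"

definition Delta_poly :: "nat \<Rightarrow> dist_poly" where
  "Delta_poly m = det (D_mat m)"

definition CM_mat :: "nat \<Rightarrow> dist_poly mat" where
  "CM_mat m = four_block_mat
     (0\<^sub>m 1 1)                     (mat 1 (m + 1) (\<lambda>_. 1))
     (mat (m + 1) 1 (\<lambda>_. 1))   (D_mat m)"

definition Gamma_poly :: "nat \<Rightarrow> dist_poly" where
  "Gamma_poly m = det (CM_mat m)"

text \<open>\<^const>\<open>Gcd\<close> on \<^typ>\<open>int\<close> is normalised to be nonnegative.\<close>
definition poly_content :: "dist_poly \<Rightarrow> int" where
  "poly_content p = Gcd (Poly_Mapping.lookup p ` Poly_Mapping.keys p)"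

end

theory Submission imports Defs begin

text \<open>
  The matrices of \<open>\<Gamma>\<^sub>n\<close> and \<open>\<Delta>\<^sub>n\<^sub>+\<^sub>1\<close> are both symmetric with zero diagonal and have size
  \<open>n + 2\<close>, and \<open>\<Gamma>\<^sub>n\<close> arises from \<open>\<Delta>\<^sub>n\<^sub>+\<^sub>1\<close> by specialising the variables of one row
  to \<open>1\<close>. The two contents are therefore handled by the same two arguments.

  A symmetric matrix with zero diagonal is congruent modulo \<open>2\<close>, entry by entry, to the
  skew-symmetric matrix with the same upper triangle. For odd \<open>n\<close> the size is odd, so the
  determinant of the skew-symmetric matrix vanishes, and all coefficients of \<open>\<Gamma>\<^sub>n\<close> and
  \<open>\<Delta>\<^sub>n\<^sub>+\<^sub>1\<close> are even (\<open>even_det_odd_size\<close>).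

  Conversely, the content of a polynomial divides each of its values at integer points
  (\<open>poly_content_dvd_eval_edges\<close>). Points with coordinates in \<open>{0, 1}\<close> turn \<open>D\<^sub>n\<^sub>+\<^sub>1\<close> into the
  adjacency matrix of a graph on \<open>n + 2\<close> vertices, and \<open>CM\<^sub>n\<close> into that of a graph in which
  vertex \<open>0\<close> is joined to all the others. So it is enough to find, for each number of vertices,
  one graph with such a dominating vertex whose adjacency matrix has determinant \<open>\<plusminus>1\<close>
  (even number of vertices) or \<open>\<plusminus>2\<close> (odd number). Adding to a graph a dominating vertex together
  with a leaf hanging from it only changes the sign of the determinant. Starting from the
  empty graph, with determinant \<open>1\<close>, or from the triangle, with determinant \<open>2\<close>, this
  yields the graphs wanted (\<open>det_nested_mat_even\<close>, \<open>det_nested_mat_odd\<close>).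
\<close>

section \<open>Symmetric matrices of odd size modulo two\<close>

lemma dvd_prod_diff:
  fixes f g :: "'b \<Rightarrow> 'a::comm_ring_1"
  assumes "\<And>x. x \<in> S \<Longrightarrow> c dvd f x - g x"
  shows "c dvd prod f S - prod g S"
  using assms
proof (induction S rule: infinite_finite_induct)
  case (insert x S)
  have "prod f (insert x S) - prod g (insert x S)
      = (f x - g x) * prod f S + g x * (prod f S - prod g S)"
    using insert.hyps by (simp add: algebra_simps)
  then show ?case using insert by simp
qed auto

lemma dvd_det_diff:
  fixes A B :: "'a::comm_ring_1 mat"
  assumes A: "A \<in> carrier_mat n n" and B: "B \<in> carrier_mat n n"
    and dvd: "\<And>i j. i < n \<Longrightarrow> j < n \<Longrightarrow> c dvd A $$ (i, j) - B $$ (i, j)"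
  shows "c dvd det A - det B"
proof -
  have "c dvd (\<Prod>i = 0..<n. A $$ (i, p i)) - (\<Prod>i = 0..<n. B $$ (i, p i))"
    if "p permutes {0..<n}" for p
    using permutes_in_image[OF that] by (intro dvd_prod_diff dvd) auto
  then show ?thesis
    unfolding det_def'[OF A] det_def'[OF B] sum_subtractf[symmetric] right_diff_distrib[symmetric]
    by (intro dvd_sum dvd_mult) auto
qed

text \<open>
  Over a ring in which \<open>2\<close> is not a zero divisor, \<open>det K = det K\<^sup>T = det (-K) = - det K\<close>
  forces the determinant of a skew-symmetric matrix \<open>K\<close> of odd size to vanish. Flipping the signs
  below the diagonal turns the given matrix into such a \<open>K\<close>.
\<close>
lemma even_det_odd_size:
  fixes M :: "'a::comm_ring_1 mat"
  assumes M: "M \<in> carrier_mat N N" and "odd N"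
    and sym: "\<And>i j. i < N \<Longrightarrow> j < N \<Longrightarrow> M $$ (i, j) = M $$ (j, i)"
    and diag: "\<And>i. i < N \<Longrightarrow> M $$ (i, i) = 0"
    and torsion_free: "\<And>x::'a. x + x = 0 \<Longrightarrow> x = 0"
  shows "2 dvd det M"
proof -
  define K where "K = mat N N (\<lambda>(i, j). if i < j then M $$ (i, j) else - M $$ (i, j))"
  have K: "K \<in> carrier_mat N N" by (simp add: K_def)
  have "transpose_mat K = (-1) \<cdot>\<^sub>m K"
    using sym diag by (intro eq_matI) (auto simp: K_def not_less le_less)
  then have "det K = (-1) ^ N * det K"
    using det_transpose[OF K] K by (metis det_smult carrier_matD(2))
  then have "det K + det K = 0" using \<open>odd N\<close> by simp
  then have "det K = 0" by (rule torsion_free)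
  moreover have "2 dvd det M - det K"
  proof (rule dvd_det_diff[OF M K])
    fix i j assume "i < N" "j < N"
    then have "M $$ (i, j) - K $$ (i, j) = (if i < j then 0 else 2 * M $$ (i, j))"
      by (simp add: K_def)
    then show "2 dvd M $$ (i, j) - K $$ (i, j)" by simp
  qed
  ultimately show ?thesis by simp
qed

section \<open>Evaluation at 0/1 points and the content\<close>

text \<open>
  The value of a polynomial at the point with coordinates \<open>1\<close> on \<open>E\<close> and \<open>0\<close> elsewhere: a monomial
  takes the value \<open>1\<close> there if all its variables lie in \<open>E\<close>, and \<open>0\<close> otherwise.
\<close>
definition eval_edges :: "(nat \<times> nat) set \<Rightarrow> dist_poly \<Rightarrow> int" where
  "eval_edges E p = (\<Sum>m\<in>Poly_Mapping.keys p.
     Poly_Mapping.lookup p m * of_bool (Poly_Mapping.keys m \<subseteq> E))"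

lemma eval_edges_zero: "eval_edges E 0 = 0"
  by (simp add: eval_edges_def)

lemma eval_edges_add: "eval_edges E (p + q) = eval_edges E p + eval_edges E q"
  unfolding eval_edges_def
  by (rule setsum_keys_plus_distrib) (simp_all add: distrib_right)

lemma eval_edges_sum: "eval_edges E (\<Sum>x\<in>S. f x) = (\<Sum>x\<in>S. eval_edges E (f x))"
  by (induction S rule: infinite_finite_induct) (simp_all add: eval_edges_zero eval_edges_add)

lemma eval_edges_single:
  "eval_edges E (Poly_Mapping.single m c) = c * of_bool (Poly_Mapping.keys m \<subseteq> E)"
  by (simp add: eval_edges_def)

lemma sum_single_lookup:
  "(\<Sum>m\<in>Poly_Mapping.keys p. Poly_Mapping.single m (Poly_Mapping.lookup p m)) = p"
  by (rule poly_mapping_eqI)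
    (simp add: lookup_sum lookup_single when_def in_keys_iff)

text \<open>No cancellation of exponents can occur, since they are natural numbers.\<close>
lemma keys_add_nat:
  fixes a b :: "'a \<Rightarrow>\<^sub>0 nat"
  shows "Poly_Mapping.keys (a + b) = Poly_Mapping.keys a \<union> Poly_Mapping.keys b"
  by (auto simp: in_keys_iff lookup_add)

lemma eval_edges_mult: "eval_edges E (p * q) = eval_edges E p * eval_edges E q"
proof -
  let ?s = "\<lambda>p m. Poly_Mapping.single m (Poly_Mapping.lookup p m) :: dist_poly"
  let ?K = "Poly_Mapping.keys :: dist_poly \<Rightarrow> _"
  have "eval_edges E (p * q) = eval_edges E ((\<Sum>m\<in>?K p. ?s p m) * (\<Sum>k\<in>?K q. ?s q k))"
    by (simp only: sum_single_lookup)
  also have "\<dots> = (\<Sum>m\<in>?K p. \<Sum>k\<in>?K q. eval_edges E (?s p m) * eval_edges E (?s q k))"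
    by (simp add: sum_product eval_edges_sum mult_single eval_edges_single keys_add_nat
        of_bool_conj mult_ac)
  also have "\<dots> = eval_edges E (\<Sum>m\<in>?K p. ?s p m) * eval_edges E (\<Sum>k\<in>?K q. ?s q k)"
    by (simp only: sum_product eval_edges_sum)
  also have "\<dots> = eval_edges E p * eval_edges E q"
    by (simp only: sum_single_lookup)
  finally show ?thesis .
qed

lemma eval_edges_one: "eval_edges E 1 = 1"
  using eval_edges_single[of E 0 1] by simp

lemma comm_ring_hom_eval_edges: "comm_ring_hom (eval_edges E)"
  by unfold_locales
    (simp_all add: eval_edges_zero eval_edges_one eval_edges_add eval_edges_mult)

lemma eval_edges_dvar: "eval_edges E (dvar i j) = of_bool ((min i j, max i j) \<in> E)"
  by (simp add: dvar_def eval_edges_single)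

lemma eval_edges_dvar_square:
  assumes "\<And>i j. P i j \<longleftrightarrow> P j i"
  shows "eval_edges {(i, j). P i j} ((dvar i j)\<^sup>2) = of_bool (P i j)"
  using assms by (simp add: eval_edges_mult eval_edges_dvar power2_eq_square min_def max_def)

lemma poly_content_dvd_eval_edges: "poly_content p dvd eval_edges E p"
  unfolding poly_content_def eval_edges_def by (intro dvd_sum dvd_mult2 Gcd_dvd) simp

lemma dvd_poly_content:
  assumes "of_int c dvd p"
  shows "c dvd poly_content p"
proof -
  obtain q where "p = of_int c * q" using assms by blast
  then have "p = Poly_Mapping.single 0 c * q" by (metis single_of_int of_int_eq_id id_apply)
  moreover have "Poly_Mapping.lookup (Poly_Mapping.single 0 c * q) m = c * Poly_Mapping.lookup q m"
    for m
  proof -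
    have "Poly_Mapping.single 0 c * q = Poly_Mapping.map ((*) c) q"
      by (rule mult_map_scale_conv_mult[symmetric])
    then show ?thesis by (simp add: Poly_Mapping.map.rep_eq when_def)
  qed
  ultimately show ?thesis
    unfolding poly_content_def by (auto intro!: Gcd_greatest)
qed

lemma dist_poly_torsion_free:
  fixes p :: dist_poly
  assumes "p + p = 0"
  shows "p = 0"
proof (rule poly_mapping_eqI)
  fix m
  have "Poly_Mapping.lookup p m + Poly_Mapping.lookup p m = 0"
    using assms by (metis lookup_add lookup_zero)
  then show "Poly_Mapping.lookup p m = Poly_Mapping.lookup 0 m" by simp
qed

lemma poly_content_nonneg: "poly_content p \<ge> 0"
  by (simp add: poly_content_def)

section \<open>Graphs with a dominating vertex and small determinant\<close>

text \<open>
  Vertices come in pairs \<open>(0, 1)\<close>, \<open>(2, 3)\<close>, and so on. The even vertex of a pair is joined to all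
  later vertices, which makes the odd one a leaf once the earlier pairs are removed. The second
  alternative adds, for odd \<open>N\<close>, the edge between the last two vertices, so that the last
  three form a triangle; for even \<open>N\<close> it adds nothing.
\<close>
definition nested_adj :: "nat \<Rightarrow> nat \<Rightarrow> nat \<Rightarrow> bool" where
  "nested_adj N i j \<longleftrightarrow> i \<noteq> j \<and> (even (min i j) \<or> min i j + 2 = N)"

lemma nested_adj_irrefl: "\<not> nested_adj N i i"
  by (simp add: nested_adj_def)

lemma nested_adj_commute: "nested_adj N i j \<longleftrightarrow> nested_adj N j i"
  by (auto simp: nested_adj_def min.commute)

lemma nested_adj_zero: "nested_adj N 0 j \<longleftrightarrow> j \<noteq> 0" "nested_adj N j 0 \<longleftrightarrow> j \<noteq> 0"
  by (auto simp: nested_adj_def)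

definition nested_mat :: "nat \<Rightarrow> int mat" where
  "nested_mat N = mat N N (\<lambda>(i, j). of_bool (nested_adj N i j))"

text \<open>
  Expanding along the row and then the column of a leaf leaves the determinant of the graph
  without the leaf and its neighbour.
\<close>
lemma det_remove_leaf:
  fixes A :: "'a::comm_ring_1 mat"
  assumes A: "A \<in> carrier_mat (n + 2) (n + 2)"
    and row: "\<And>j. j < n + 2 \<Longrightarrow> A $$ (1, j) = of_bool (j = 0)"
    and col: "\<And>i. i < n + 2 \<Longrightarrow> A $$ (i, 1) = of_bool (i = 0)"
  shows "det A = - det (mat n n (\<lambda>(i, j). A $$ (i + 2, j + 2)))"
proof -
  let ?B = "mat_delete A 1 0"
  have B: "?B \<in> carrier_mat (n + 1) (n + 1)" using mat_delete_carrier[OF A] by simp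
  have "det A = (\<Sum>j<n + 2. A $$ (1, j) * cofactor A 1 j)"
    by (rule laplace_expansion_row[OF A]) simp
  also have "\<dots> = (\<Sum>j<n + 2. if j = 0 then cofactor A 1 0 else 0)"
    by (rule sum.cong) (use row in auto)
  also have "\<dots> = - det ?B" by (simp add: cofactor_def)
  also have "det ?B = (\<Sum>i<n + 1. ?B $$ (i, 0) * cofactor ?B i 0)"
    by (rule laplace_expansion_column[OF B]) simp
  also have "\<dots> = (\<Sum>i<n + 1. if i = 0 then cofactor ?B 0 0 else 0)"
    by (rule sum.cong) (use A col in \<open>auto simp: mat_delete_def\<close>)
  also have "\<dots> = det (mat_delete ?B 0 0)" by (simp add: cofactor_def)
  also have "mat_delete ?B 0 0 = mat n n (\<lambda>(i, j). A $$ (i + 2, j + 2))"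
    using A by (intro eq_matI) (auto simp: mat_delete_def)
  finally show ?thesis .
qed

text \<open>
  For \<open>N = 1\<close> the added edge of the final triangle would meet vertex \<open>1\<close>, which is then not a leaf.
\<close>
lemma det_nested_mat_step:
  assumes "N \<noteq> 1"
  shows "det (nested_mat (Suc (Suc N))) = - det (nested_mat N)"
proof -
  have "det (nested_mat (N + 2))
      = - det (mat N N (\<lambda>(i, j). nested_mat (N + 2) $$ (i + 2, j + 2)))"
    by (rule det_remove_leaf) (use assms in \<open>auto simp: nested_mat_def nested_adj_def min_def Suc_le_eq\<close>)
  also have "mat N N (\<lambda>(i, j). nested_mat (N + 2) $$ (i + 2, j + 2)) = nested_mat N"
    by (intro eq_matI) (auto simp: nested_mat_def nested_adj_def)
  finally show ?thesis by simp
qed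

lemma det_nested_mat_even: "even N \<Longrightarrow> \<bar>det (nested_mat N)\<bar> = 1"
proof (induction N rule: nat_induct2)
  case 0
  then show ?case by (simp add: nested_mat_def)
next
  case (step N)
  then have "N \<noteq> 1" by auto
  with step show ?case by (simp add: det_nested_mat_step)
qed simp

lemma det_nested_mat_three: "det (nested_mat 3) = 2"
proof -
  have C: "nested_mat 3 \<in> carrier_mat 3 3" by (simp add: nested_mat_def)
  have two: "det B = B $$ (0, 0) * B $$ (1, 1) - B $$ (0, 1) * B $$ (1, 0)"
    if "B \<in> carrier_mat 2 2" for B :: "int mat"
    using that
    by (simp add: laplace_expansion_row[OF that, of 0] numeral_2_eq_2 cofactor_def
        det_single mat_delete_carrier mat_delete_def)
  have D: "mat_delete (nested_mat 3) 0 j \<in> carrier_mat 2 2" for j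
    using mat_delete_carrier[OF C] by simp
  have S: "{..<3} = {0, 1, 2 :: nat}" by auto
  show ?thesis
    unfolding laplace_expansion_row[OF C, of 0, simplified] S
    by (simp add: cofactor_def two[OF D])
      (simp add: mat_delete_def nested_mat_def nested_adj_def)
qed

lemma det_nested_mat_odd: "odd N \<Longrightarrow> N \<ge> 3 \<Longrightarrow> \<bar>det (nested_mat N)\<bar> = 2"
proof (induction N rule: nat_induct2)
  case (step N)
  show ?case
  proof (cases "N = 1")
    case True
    then show ?thesis using det_nested_mat_three by (simp add: numeral_3_eq_3)
  next
    case False
    with step.prems have "odd N" "N \<ge> 3" by presburger+
    with step.IH False show ?thesis by (simp add: det_nested_mat_step)
  qed
qed auto

section \<open>The two determinants\<close>

lemma CM_mat_eq:
  "CM_mat n = mat (n + 2) (n + 2) (\<lambda>(i, j).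
     if i = j then 0 else if i = 0 \<or> j = 0 then 1 else (dvar (i - 1) (j - 1))\<^sup>2)"
  by (rule eq_matI) (auto simp: CM_mat_def D_mat_def four_block_mat_def Let_def)

lemma dvar_commute: "dvar i j = dvar j i"
  by (simp add: dvar_def min.commute max.commute)

lemma even_poly_content:
  assumes "odd n"
  shows "even (poly_content (Gamma_poly n))" and "even (poly_content (Delta_poly (n + 1)))"
proof -
  have "2 dvd det (CM_mat n)"
  proof (rule even_det_odd_size)
    show "odd (n + 2)" using assms by simp
  qed (auto simp: CM_mat_eq dvar_commute intro: dist_poly_torsion_free)
  then show "even (poly_content (Gamma_poly n))"
    using dvd_poly_content[of 2] by (simp add: Gamma_poly_def)
  have "2 dvd det (D_mat (n + 1))"
  proof (rule even_det_odd_size)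
    show "odd (n + 2)" using assms by simp
  qed (auto simp: D_mat_def dvar_commute intro: dist_poly_torsion_free)
  then show "even (poly_content (Delta_poly (n + 1)))"
    using dvd_poly_content[of 2] by (simp add: Delta_poly_def)
qed

text \<open>
  Vertex \<open>0\<close> of the nested graph is the bordering index of \<open>CM\<^sub>n\<close>, so in that case the other
  vertices are shifted by one.
\<close>
lemma poly_content_dvd_det_nested_mat:
  shows "poly_content (Gamma_poly n) dvd det (nested_mat (n + 2))"
    and "poly_content (Delta_poly (n + 1)) dvd det (nested_mat (n + 2))"
proof -
  let ?G = "{(i, j). nested_adj (n + 2) (Suc i) (Suc j)}"
  let ?D = "{(i, j). nested_adj (n + 2) i j}"
  have G: "map_mat (eval_edges ?G) (CM_mat n) = nested_mat (n + 2)"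
    by (rule eq_matI)
      (auto simp: CM_mat_eq nested_mat_def nested_adj_irrefl nested_adj_zero eval_edges_zero
        eval_edges_one eval_edges_dvar_square[OF nested_adj_commute])
  have D: "map_mat (eval_edges ?D) (D_mat (n + 1)) = nested_mat (n + 2)"
    by (rule eq_matI)
      (auto simp: D_mat_def nested_mat_def nested_adj_irrefl eval_edges_zero
        eval_edges_dvar_square[OF nested_adj_commute])
  show "poly_content (Gamma_poly n) dvd det (nested_mat (n + 2))"
    using poly_content_dvd_eval_edges[of "Gamma_poly n" ?G]
    by (simp only: Gamma_poly_def G comm_ring_hom.hom_det[OF comm_ring_hom_eval_edges, symmetric])
  show "poly_content (Delta_poly (n + 1)) dvd det (nested_mat (n + 2))"
    using poly_content_dvd_eval_edges[of "Delta_poly (n + 1)" ?D]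
    by (simp only: Delta_poly_def D comm_ring_hom.hom_det[OF comm_ring_hom_eval_edges, symmetric])
qed

theorem theorem1p3:
  fixes n :: nat
  assumes "n \<ge> 1"
  shows "(even n \<longrightarrow> poly_content (Gamma_poly n) = 1 \<and> poly_content (Delta_poly (n + 1)) = 1) \<and>
         (odd n \<longrightarrow> poly_content (Gamma_poly n) = 2 \<and> poly_content (Delta_poly (n + 1)) = 2)"
proof (intro conjI impI)
  note dvd = poly_content_dvd_det_nested_mat[of n]
  have one: "c = 1" if "c \<ge> 0" "c dvd d" "\<bar>d\<bar> = 1" for c d :: int
    using that by (metis abs_of_nonneg zdvd1_eq dvd_abs_iff)
  have two: "c = 2" if "c \<ge> 0" "c dvd d" "\<bar>d\<bar> = 2" "even c" for c d :: int
    using that by (metis zdvd_antisym_nonneg dvd_abs_iff zero_le_numeral)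
  show "poly_content (Gamma_poly n) = 1" "poly_content (Delta_poly (n + 1)) = 1" if "even n"
    using one[OF poly_content_nonneg dvd(1)] one[OF poly_content_nonneg dvd(2)]
      det_nested_mat_even[of "n + 2"] that by simp_all
  show "poly_content (Gamma_poly n) = 2" "poly_content (Delta_poly (n + 1)) = 2" if "odd n"
    using two[OF poly_content_nonneg dvd(1)] two[OF poly_content_nonneg dvd(2)]
      det_nested_mat_odd[of "n + 2"] even_poly_content[OF that] assms that by simp_all
qed

end
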